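(* Let $P$ be a program whose controlled inputs $\mathcal A$ and uncontrolled inputs $\mathcal X$ are represented by boolean variables $a=(a_1,\dots,a_n)$ and $x=(x_1,\dots,x_m)$, with propositional formulas $h_a(a)$ and $h_x(x)$ specifying the valid inputs. Let $O$ be a set of finite traces, $\pi$ a path of $P$, and suppose the path constraint $\mathrm{pc}_\pi^O(a,x)$ is expressed as a propositional formula. Then the path-wise quantitative robustness of $\pi$ reduces to functional E-MAJSAT as follows: $$q(P|^{\pi},O)=\frac{\mathrm{emajsat}_{a}\big(h_a(a)\wedge h_x(x)\wedge \mathrm{pc}_\pi^O(a,x)\big)}{\sharp(h_x)}.$$
   Context: A program $P$ is a deterministic transition system (each state has at most one successor). An input of $P$ is a pair $(a,x)$ with $a\in\mathcal A$ (controlled input) and $x\in\mathcal X$ (uncontrolled input), and determines the initial state. A (finite) trace is a finite sequence of consecutive states starting from an initial state; $T(P|_{(a,x)})$ is the set of traces of $P$ starting in the initial state determined by $(a,x)$. Each state has an associated source location; a path is a finite sequence of locations, and a trace follows the path given by the locations of its states. The restriction $P|^{\pi}$ of $P$ to the path $\pi$ has as traces on input $(a,x)$ exactly those traces in $T(P|_{(a,x)})$ which follow $\pi$. Quantitative robustness of a program $P'$ with these inputs: $$q(P',O)=\frac1{|\mathcal X|}\max_{a\in\mathcal A}\left|\left\{x\in\mathcal X\mid T(P'|_{(a,x)})\cap O\neq\varnothing\right\}\right|.$$ The path-wise quantitative robustness of $\pi$ is $q(P|^{\pi},O)$. Let $\mathbb B=\{\top,\bot\}$. $\mathcal A$ is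 identified with the set of valuations of $a_1,\dots,a_n$ satisfying $h_a$ and $\mathcal X$ with the set of valuations of $x_1,\dots,x_m$ satisfying $h_x$, so that $\sharp(h_a)=|\mathcal A|$ and $\sharp(h_x)=|\mathcal X|$; both are nonempty. The path constraint $\mathrm{pc}_\pi^O(a,x)$ is a formula over the variables $a,x$ which holds, for a valid input $(a,x)\in\mathcal A\times\mathcal X$, exactly when on this input $P$ goes along $\pi$ and reaches the goal $O$, i.e. when $T(P|^{\pi}|_{(a,x)})\cap O\ne\varnothing$. $\sharp(f)$ denotes the number of models (satisfying valuations) of $f$ over its variables ($h_x$ is regarded as a formula over all of $x_1,\dots,x_m$, and $h_a$ over all of $a_1,\dots,a_n$). For a formula $f$ over variables partitioned into choice variables $A$ and chance variables $X$, and $\alpha\in\mathbb B^A$, $f|_\alpha$ is $f$ with the variables of $A$ replaced by their values under $\alpha$ (a formula over $X$), and $$\mathrm{emajsat}_A(f)=\max_{\alpha\in\mathbb B^A}\sharp(f|_\alpha),$$ models being counted over the variables $X$. In the claim, the choice variables are $a_1,\dots,a_n$ and the chance variables are $x_1,\dots,x_m$. *)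

theory Defs
  imports Complex_Main "HOL-Library.FuncSet"
begin

section \<open>Programs, traces and robustness\<close>

text \<open>The transition relation is required to be single-valued separately, by
  \<open>deterministic\<close>.\<close>

record ('s, 'l, 'a, 'x) program =
  step :: "('s \<times> 's) set"
  init :: "'a \<Rightarrow> 'x \<Rightarrow> 's"
  loc :: "'s \<Rightarrow> 'l"
  ctrl :: "'a set"
  unctrl :: "'x set"

definition deterministic :: "('s, 'l, 'a, 'x) program \<Rightarrow> bool" where
  "deterministic P \<longleftrightarrow> single_valued (step P)"

definition traces :: "('s, 'l, 'a, 'x) program \<Rightarrow> 'a \<Rightarrow> 'x \<Rightarrow> 's list set" where
  "traces P a x =
     {t. t \<noteq> [] \<and> hd t = init P a x \<and> successively (\<lambda>s s'. (s, s') \<in> step P) t}"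

text \<open>The restriction of a program to a path is given by its traces only: these are not
  closed under prefixes, so in general they are not the traces of a transition system.
  Accordingly, the robustness takes a family of trace sets, indexed by the inputs, in place
  of a program.\<close>

definition path_traces ::
  "('s, 'l, 'a, 'x) program \<Rightarrow> 'l list \<Rightarrow> 'a \<Rightarrow> 'x \<Rightarrow> 's list set" where
  "path_traces P \<pi> a x = {t \<in> traces P a x. map (loc P) t = \<pi>}"

definition robustness ::
  "'a set \<Rightarrow> 'x set \<Rightarrow> ('a \<Rightarrow> 'x \<Rightarrow> 's list set) \<Rightarrow> 's list set \<Rightarrow> real" where
  "robustness \<A> \<X> T G =
     1 / real (card \<X>) * real (Max ((\<lambda>a. card {x \<in> \<X>. T a x \<inter> G \<noteq> {}}) ` \<A>))"

definition path_robustness ::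
  "('s, 'l, 'a, 'x) program \<Rightarrow> 'l list \<Rightarrow> 's list set \<Rightarrow> real" where
  "path_robustness P \<pi> G = robustness (ctrl P) (unctrl P) (path_traces P \<pi>) G"


section \<open>Propositional formulas and functional E-MAJSAT\<close>

datatype (fvars: 'v) form =
    Const bool
  | Var 'v
  | Neg "'v form"
  | Conj "'v form" "'v form"
  | Disj "'v form" "'v form"

primrec holds :: "('v \<Rightarrow> bool) \<Rightarrow> 'v form \<Rightarrow> bool" where
  "holds \<sigma> (Const b) \<longleftrightarrow> b"
| "holds \<sigma> (Var v) \<longleftrightarrow> \<sigma> v"
| "holds \<sigma> (Neg f) \<longleftrightarrow> \<not> holds \<sigma> f"
| "holds \<sigma> (Conj f g) \<longleftrightarrow> holds \<sigma> f \<and> holds \<sigma> g"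
| "holds \<sigma> (Disj f g) \<longleftrightarrow> holds \<sigma> f \<or> holds \<sigma> g"

text \<open>Valuations of a set of variables are extensional functions, so that each is counted once.\<close>

abbreviation valuations :: "'v set \<Rightarrow> ('v \<Rightarrow> bool) set" where
  "valuations V \<equiv> V \<rightarrow>\<^sub>E UNIV"

text \<open>The variables over which models are taken are explicit, because a formula
  need not mention all of them.\<close>

definition models :: "'v set \<Rightarrow> 'v form \<Rightarrow> ('v \<Rightarrow> bool) set" where
  "models V f = {\<sigma> \<in> valuations V. holds \<sigma> f}"

definition num_models :: "'v set \<Rightarrow> 'v form \<Rightarrow> nat" where
  "num_models V f = card (models V f)"

primrec instantiate :: "'v set \<Rightarrow> ('v \<Rightarrow> bool) \<Rightarrow> 'v form \<Rightarrow> 'v form" where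
  "instantiate A \<alpha> (Const b) = Const b"
| "instantiate A \<alpha> (Var v) = (if v \<in> A then Const (\<alpha> v) else Var v)"
| "instantiate A \<alpha> (Neg f) = Neg (instantiate A \<alpha> f)"
| "instantiate A \<alpha> (Conj f g) = Conj (instantiate A \<alpha> f) (instantiate A \<alpha> g)"
| "instantiate A \<alpha> (Disj f g) = Disj (instantiate A \<alpha> f) (instantiate A \<alpha> g)"

text \<open>\<open>A\<close> are the choice variables and \<open>X\<close> the chance variables.\<close>

definition emajsat :: "'v set \<Rightarrow> 'v set \<Rightarrow> 'v form \<Rightarrow> nat" where
  "emajsat A X f = Max ((\<lambda>\<alpha>. num_models X (instantiate A \<alpha> f)) ` valuations A)"


section \<open>Boolean representation of inputs and path constraints\<close>

datatype input_var = AVar nat | XVar nat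

definition avars :: "nat \<Rightarrow> input_var set" where
  "avars n = AVar ` {1..n}"

definition xvars :: "nat \<Rightarrow> input_var set" where
  "xvars m = XVar ` {1..m}"

text \<open>The bijections \<open>ra\<close> and \<open>rx\<close> make the identification of inputs with valuations explicit.\<close>

definition represents_inputs ::
  "('s, 'l, 'a, 'x) program \<Rightarrow> nat \<Rightarrow> nat \<Rightarrow> input_var form \<Rightarrow> input_var form \<Rightarrow>
   ('a \<Rightarrow> input_var \<Rightarrow> bool) \<Rightarrow> ('x \<Rightarrow> input_var \<Rightarrow> bool) \<Rightarrow> bool" where
  "represents_inputs P n m ha hx ra rx \<longleftrightarrow>
     fvars ha \<subseteq> avars n \<and> fvars hx \<subseteq> xvars m \<and>
     bij_betw ra (ctrl P) (models (avars n) ha) \<and>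
     bij_betw rx (unctrl P) (models (xvars m) hx)"

text \<open>\<open>override_on (rx x) (ra a) (avars n)\<close> is the joint valuation of all input variables
  that agrees with \<open>ra a\<close> on the controlled and with \<open>rx x\<close> on the uncontrolled ones.\<close>

definition path_constraint ::
  "('s, 'l, 'a, 'x) program \<Rightarrow> nat \<Rightarrow> nat \<Rightarrow>
   ('a \<Rightarrow> input_var \<Rightarrow> bool) \<Rightarrow> ('x \<Rightarrow> input_var \<Rightarrow> bool) \<Rightarrow>
   'l list \<Rightarrow> 's list set \<Rightarrow> input_var form \<Rightarrow> bool" where
  "path_constraint P n m ra rx \<pi> G pc \<longleftrightarrow>
     fvars pc \<subseteq> avars n \<union> xvars m \<and>
     (\<forall>a \<in> ctrl P. \<forall>x \<in> unctrl P.
        holds (override_on (rx x) (ra a) (avars n)) pc \<longleftrightarrow> path_traces P \<pi> a x \<inter> G \<noteq> {})"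

end

theory Submission
  imports Defs
begin

text \<open>A choice of the controlled variables that violates \<open>ha\<close> contributes no models, so the
  maximum in E-MAJSAT may be taken over valid controlled inputs only. For such an input, the chance
  valuations that are counted correspond under \<open>rx\<close> to the uncontrolled inputs that reach the goal.\<close>

lemma holds_cong: "(\<And>v. v \<in> fvars f \<Longrightarrow> \<sigma> v = \<tau> v) \<Longrightarrow> holds \<sigma> f \<longleftrightarrow> holds \<tau> f"
  by (induction f) auto

text \<open>Trades substitution in the formula for a change of valuation; \<open>override_on\<close>
  is also how \<open>path_constraint\<close> joins the two halves of an input.\<close>

lemma holds_instantiate: "holds \<sigma> (instantiate A \<alpha> f) \<longleftrightarrow> holds (override_on \<sigma> \<alpha> A) f"
  by (induction f) auto

lemma holds_override_on_choice:
  "fvars f \<subseteq> A \<Longrightarrow> holds (override_on \<sigma> \<alpha> A) f \<longleftrightarrow> holds \<alpha> f"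
  by (rule holds_cong) auto

lemma holds_override_on_chance:
  "fvars f \<inter> A = {} \<Longrightarrow> holds (override_on \<sigma> \<alpha> A) f \<longleftrightarrow> holds \<sigma> f"
  by (rule holds_cong) (auto simp: override_on_def)

text \<open>Under the joint valuation \<open>ha\<close> sees only \<alpha> and \<open>hx\<close>
  only \<sigma>. So \<open>ha\<close> is constant during the count, \<open>hx\<close> selects the
  chance valuations, and only \<open>pc\<close> depends on both.\<close>

lemma num_models_instantiate_Conj:
  assumes "fvars ha \<subseteq> A" and "fvars hx \<inter> A = {}"
  shows "num_models X (instantiate A \<alpha> (Conj ha (Conj hx pc))) =
    (if holds \<alpha> ha then card {\<sigma> \<in> models X hx. holds (override_on \<sigma> \<alpha> A) pc} else 0)"
proof -
  have "models X (instantiate A \<alpha> (Conj ha (Conj hx pc))) =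
      (if holds \<alpha> ha then {\<sigma> \<in> models X hx. holds (override_on \<sigma> \<alpha> A) pc} else {})"
    using assms
    by (auto simp: models_def holds_instantiate holds_override_on_choice holds_override_on_chance)
  then show ?thesis
    by (simp add: num_models_def)
qed

text \<open>As 0 is the least natural number, points of \<open>S - B\<close> cannot exceed a value
  attained on \<open>B\<close>, and \<open>B \<noteq> {}\<close> provides one.\<close>

lemma Max_image_nat_mono_neutral:
  fixes g :: "'b \<Rightarrow> nat"
  assumes "finite S" and "B \<subseteq> S" and "B \<noteq> {}" and "\<And>b. b \<in> S - B \<Longrightarrow> g b = 0"
  shows "Max (g ` S) = Max (g ` B)"
proof (rule antisym)
  have "finite B"
    using assms by (blast intro: finite_subset)
  show "Max (g ` B) \<le> Max (g ` S)"
    using assms by (intro Max_mono) auto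
  have "g b \<le> Max (g ` B)" if "b \<in> S" for b
    using that assms(4) \<open>finite B\<close> by (cases "b \<in> B") auto
  then show "Max (g ` S) \<le> Max (g ` B)"
    using assms by (subst Max_le_iff) auto
qed

text \<open>\<open>P\<close> is the pullback of \<open>Q\<close> along \<open>f\<close>, so
  \<open>f\<close> restricts to a bijection between the two selected subsets.\<close>

lemma card_Collect_bij_betw:
  assumes "bij_betw f X Y" and "\<And>x. x \<in> X \<Longrightarrow> Q (f x) \<longleftrightarrow> P x"
  shows "card {y \<in> Y. Q y} = card {x \<in> X. P x}"
proof -
  have "f ` {x \<in> X. P x} = {y \<in> Y. Q y}"
    using assms by (auto simp: bij_betw_def)
  moreover have "inj_on f {x \<in> X. P x}"
    using assms(1) by (auto simp: bij_betw_def intro: inj_on_subset)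
  ultimately show ?thesis
    using card_image by metis
qed

theorem proposition6p2:
  fixes P :: "('s, 'l, 'a, 'x) program"
    and n m :: nat
    and ha hx pc :: "input_var form"
    and ra :: "'a \<Rightarrow> input_var \<Rightarrow> bool"
    and rx :: "'x \<Rightarrow> input_var \<Rightarrow> bool"
    and G :: "'s list set"
    and \<pi> :: "'l list"
  assumes "deterministic P"
    and "ctrl P \<noteq> {}" and "unctrl P \<noteq> {}"
    and "represents_inputs P n m ha hx ra rx"
    and "path_constraint P n m ra rx \<pi> G pc"
  shows "path_robustness P \<pi> G =
    real (emajsat (avars n) (xvars m) (Conj ha (Conj hx pc))) / real (num_models (xvars m) hx)"
proof -
  let ?A = "avars n" and ?X = "xvars m"
  let ?f = "Conj ha (Conj hx pc)"
  let ?g = "\<lambda>\<alpha>. num_models ?X (instantiate ?A \<alpha> ?f)"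
  have ha: "fvars ha \<subseteq> ?A" and hx: "fvars hx \<subseteq> ?X"
    and ra: "bij_betw ra (ctrl P) (models ?A ha)" and rx: "bij_betw rx (unctrl P) (models ?X hx)"
    using assms(4) by (auto simp: represents_inputs_def)
  \<comment> \<open>\<open>AVar\<close> and \<open>XVar\<close> are distinct constructors, so choice
    and chance variables never clash.\<close>
  have hx_A: "fvars hx \<inter> ?A = {}"
    using hx by (auto simp: avars_def xvars_def)
  note g = num_models_instantiate_Conj[OF ha hx_A]
  have ra_image: "models ?A ha = ra ` ctrl P"
    using ra by (simp add: bij_betw_def)
  have "finite (valuations ?A)"
    by (auto simp: avars_def intro: finite_PiE)
  then have "emajsat ?A ?X ?f = Max (?g ` models ?A ha)"
    unfolding emajsat_def
  proof (rule Max_image_nat_mono_neutral)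
    show "models ?A ha \<noteq> {}"
      using assms(2) ra_image by simp
  \<comment> \<open>Outside \<open>models ?A ha\<close> the formula \<open>ha\<close> fails, and
    \<open>g\<close> gives the count 0.\<close>
  qed (auto simp only: models_def g split: if_splits)
  also have "\<dots> = Max ((\<lambda>a. ?g (ra a)) ` ctrl P)"
    by (simp add: ra_image image_image)
  also have "(\<lambda>a. ?g (ra a)) ` ctrl P =
      (\<lambda>a. card {x \<in> unctrl P. path_traces P \<pi> a x \<inter> G \<noteq> {}}) ` ctrl P"
  proof (rule image_cong[OF refl])
    fix a assume a: "a \<in> ctrl P"
    then have "holds (ra a) ha"
      using ra_image by (auto simp: models_def)
    then have "?g (ra a) = card {\<sigma> \<in> models ?X hx. holds (override_on \<sigma> (ra a) ?A) pc}"
      by (simp only: g if_True)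
    also have "\<dots> = card {x \<in> unctrl P. path_traces P \<pi> a x \<inter> G \<noteq> {}}"
      \<comment> \<open>For \<sigma> = \<open>rx x\<close> the overridden valuation is exactly the
        joint one at which \<open>path_constraint\<close> evaluates \<open>pc\<close>.\<close>
      using a assms(5) by (intro card_Collect_bij_betw[OF rx]) (auto simp: path_constraint_def)
    finally show "?g (ra a) = card {x \<in> unctrl P. path_traces P \<pi> a x \<inter> G \<noteq> {}}" .
  qed
  finally show ?thesis
    \<comment> \<open>The numerators agree by now; \<open>rx\<close> also matches the denominators
      \<open>card (unctrl P)\<close> and \<open>num_models ?X hx\<close>.\<close>
    using bij_betw_same_card[OF rx]
    by (simp add: path_robustness_def robustness_def num_models_def)
qed

end
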